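(* Let $n\ge 2$ and let $\{1,\dots,n\}=C\,\dot\cup\,D$ be a partition with $|C|=m\ge 1$ and $|D|=n-m\ge 1$. Let $S\in\mathbb{C}^{n\times n}$ be an arbitrary matrix, $\xi\in\mathbb{R}$ with $\xi\neq 0$, $P=\mathrm{diag}(\mathbf 1_{i\in C})$, and let $\widehat K\in\mathbb{C}^{n\times n}$ be Hermitian positive definite; all of these are fixed independently of $b$. For $b>0$ set $$\widehat A=S+ib\xi P,\qquad \widehat G=\widehat A\,\widehat K\,\widehat A^{\mathsf H}.$$ Then, for $b$ large enough, $\widehat G_{CC}$ is invertible and $$\widehat G/\widehat G_{CC}=S_{DD}\,\bigl(\widehat K/\widehat K_{CC}\bigr)\,S_{DD}^{\mathsf H}+O(b^{-1})\qquad(b\to\infty).$$ In particular, the limit depends neither on the blocks $S_{DC}$, $S_{CD}$ of $S$, nor on the blocks $\widehat K_{DD}$, $\widehat K_{CD}$ of $\widehat K$ other than through the Schur complement $\widehat K/\widehat K_{CC}$.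
   Context: $M^{\mathsf H}$ denotes the conjugate transpose. For $M\in\mathbb{C}^{n\times n}$ and the partition $\{1,\dots,n\}=C\,\dot\cup\,D$, the blocks of $M$ are denoted $M_{CC}\in\mathbb{C}^{m\times m}$, $M_{CD}$, $M_{DC}$, $M_{DD}$ (rows indexed by the first subscript, columns by the second). When $M_{CC}$ is invertible, the Schur complement of $M_{CC}$ in $M$ is $M/M_{CC}:=M_{DD}-M_{DC}M_{CC}^{-1}M_{CD}$. The term $O(b^{-1})$ is understood in operator norm as $b\to\infty$. *)

theory Defs
  imports
    "Jordan_Normal_Form.DL_Submatrix"
    "Jordan_Normal_Form.Schur_Decomposition"
    "HOL-Analysis.L2_Norm"
    "HOL-Library.Landau_Symbols"
begin

text \<open>
  Matrices have type \<^typ>\<open>complex mat\<close>, with rows and columns indexed by \<open>{..<n}\<close>.  For index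
  sets \<open>I\<close> and \<open>J\<close>, the block \<open>M\<^sub>I\<^sub>J\<close> is \<open>submatrix M I J\<close>, whose rows and columns are
  listed in increasing index order.  The conjugate transpose is \<^const>\<open>mat_adjoint\<close>.
\<close>

text \<open>Unspecified if the matrix is not invertible.\<close>

definition mat_inv :: "complex mat \<Rightarrow> complex mat" where
  "mat_inv A = the (mat_inverse A)"

lemma mat_inv:
  assumes A: "A \<in> carrier_mat k k" and inv: "invertible_mat A"
  shows "mat_inv A \<in> carrier_mat k k" "A * mat_inv A = 1\<^sub>m k" "mat_inv A * A = 1\<^sub>m k"
proof -
  from inv obtain B where AB: "A * B = 1\<^sub>m k" and BA: "B * A = 1\<^sub>m (dim_row B)"
    using A unfolding invertible_mat_def inverts_mat_def by auto
  have "dim_col B = k" using arg_cong[OF AB, of dim_col] by simp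
  moreover have "dim_row B = k" using arg_cong[OF BA, of dim_col] A by simp
  ultimately have B: "B \<in> carrier_mat k k" by auto
  have "A \<in> Units (ring_mat TYPE(complex) k ())"
    using A B AB BA unfolding Units_def ring_mat_def by auto
  with mat_inverse(1)[OF A, where b = "()"] obtain X where "mat_inverse A = Some X"
    by (cases "mat_inverse A") auto
  with mat_inverse(2)[OF A this]
  show "mat_inv A \<in> carrier_mat k k" "A * mat_inv A = 1\<^sub>m k" "mat_inv A * A = 1\<^sub>m k"
    by (auto simp: mat_inv_def)
qed

text \<open>\<open>schur_compl M C D\<close> is \<open>M/M\<^sub>C\<^sub>C\<close>; it is meaningful only if \<open>M\<^sub>C\<^sub>C\<close> is invertible.\<close>

definition schur_compl :: "complex mat \<Rightarrow> nat set \<Rightarrow> nat set \<Rightarrow> complex mat" where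
  "schur_compl M C D =
     submatrix M D D - submatrix M D C * mat_inv (submatrix M C C) * submatrix M C D"

text \<open>
  Here \<open>(K *\<^sub>v v) \<bullet>c v\<close> is \<open>v\<^sup>H K v\<close>, which is real because \<open>K\<close> is Hermitian, so that taking
  the real part loses nothing.
\<close>

definition hermitian_pos_def :: "nat \<Rightarrow> complex mat \<Rightarrow> bool" where
  "hermitian_pos_def n K \<longleftrightarrow>
     K \<in> carrier_mat n n \<and> mat_adjoint K = K \<and>
     (\<forall>v \<in> carrier_vec n. v \<noteq> 0\<^sub>v n \<longrightarrow> Re ((K *\<^sub>v v) \<bullet>c v) > 0)"

definition vec_norm2 :: "complex vec \<Rightarrow> real" where
  "vec_norm2 v = L2_set (\<lambda>i. cmod (v $ i)) {..<dim_vec v}"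

definition op_norm :: "complex mat \<Rightarrow> real" where
  "op_norm A = (SUP v \<in> {v \<in> carrier_vec (dim_col A). vec_norm2 v \<le> 1}. vec_norm2 (A *\<^sub>v v))"

definition mat_P :: "nat \<Rightarrow> nat set \<Rightarrow> complex mat" where
  "mat_P n C = mat_diag n (\<lambda>i. if i \<in> C then 1 else 0)"

definition A_hat :: "nat \<Rightarrow> nat set \<Rightarrow> complex mat \<Rightarrow> real \<Rightarrow> real \<Rightarrow> complex mat" where
  "A_hat n C S \<xi> b = S + (\<i> * complex_of_real b * complex_of_real \<xi>) \<cdot>\<^sub>m mat_P n C"

definition G_hat ::
  "nat \<Rightarrow> nat set \<Rightarrow> complex mat \<Rightarrow> complex mat \<Rightarrow> real \<Rightarrow> real \<Rightarrow> complex mat" where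
  "G_hat n C S K \<xi> b = A_hat n C S \<xi> b * K * mat_adjoint (A_hat n C S \<xi> b)"

end

theory Submission
  imports Defs
begin

text \<open>
  Let \<open>\<beta> = \<i> b \<xi>\<close> and list the indices of \<open>C\<close> first.  The matrix \<open>S + \<beta> P\<close> diverges, but only on the rows
  of \<open>C\<close>, and these are the rows that the Schur complement eliminates.  To make this precise, factor
  \<open>S + \<beta> P = B R\<close>, where \<open>B\<close> has the block rows \<open>[\<beta> I, 0]\<close> and \<open>[S\<^sub>D\<^sub>C, I]\<close> (\<open>row_op_mult_reduced\<close>).  The
  remaining factor \<open>R\<close> differs from the block diagonal matrix \<open>R\<^sub>0 = diag(I, S\<^sub>D\<^sub>D)\<close> by a fixed matrix
  divided by \<open>\<beta>\<close>.

  The algebraic core is the behaviour of Schur complements under congruence by a block lower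
  triangular matrix \<open>L\<close> (\<open>schur_compl_congruence\<close>):
  \<open>(L M L\<^sup>H)/(L M L\<^sup>H)\<^sub>C\<^sub>C = L\<^sub>D\<^sub>D (M/M\<^sub>C\<^sub>C) L\<^sub>D\<^sub>D\<^sup>H\<close>.
  It is used twice.  With \<open>L = B\<close>, whose lower right block is \<open>I\<close>, it shows that \<open>B (R K R\<^sup>H) B\<^sup>H\<close>, the
  matrix of the theorem, has the same Schur complement as \<open>R K R\<^sup>H\<close>; the divergent factor is gone.  With
  \<open>L = R\<^sub>0\<close> and \<open>M = K\<close> it evaluates the Schur complement of the limit \<open>R\<^sub>0 K R\<^sub>0\<^sup>H\<close> as
  \<open>S\<^sub>D\<^sub>D (K/K\<^sub>C\<^sub>C) S\<^sub>D\<^sub>D\<^sup>H\<close>.  The block \<open>K\<^sub>C\<^sub>C\<close> is invertible because \<open>K\<close> is positive definite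
  (\<open>hermitian_pos_def_block_invertible\<close>).

  What remains is that \<open>R K R\<^sup>H = R\<^sub>0 K R\<^sub>0\<^sup>H + O(1/b)\<close> implies the same for the Schur complements
  (\<open>mat_O_close_schur_compl\<close>).  Convergence with rate \<open>1/b\<close> is preserved by sums, products, conjugation and
  by division when the limit of the denominator is nonzero; entrywise this covers matrix products, blocks,
  adjoints and, by Cramer's rule, inverses.  In a fixed dimension entrywise estimates bound the operator norm
  (\<open>op_norm_bigo\<close>).  The limit contains \<open>S\<close> only through \<open>S\<^sub>D\<^sub>D\<close> and \<open>K\<close> only through its Schur
  complement, which gives the last claim.
\<close>

section \<open>Blocks of matrices\<close>

lemma submatrix_carrier:
  assumes "M \<in> carrier_mat n n'" "I \<subseteq> {..<n}" "J \<subseteq> {..<n'}"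
  shows "submatrix M I J \<in> carrier_mat (card I) (card J)"
proof -
  have "{i. i < n \<and> i \<in> I} = I" "{j. j < n' \<and> j \<in> J} = J" using assms by auto
  then show ?thesis using assms(1) by (auto simp: submatrix_def)
qed

lemma submatrix_entry:
  assumes "M \<in> carrier_mat n n'" "I \<subseteq> {..<n}" "J \<subseteq> {..<n'}" "i < card I" "j < card J"
  shows "submatrix M I J $$ (i,j) = M $$ (pick I i, pick J j)"
proof -
  have "{i. i < n \<and> i \<in> I} = I" "{j. j < n' \<and> j \<in> J} = J" using assms by auto
  then show ?thesis using assms by (auto simp: submatrix_def)
qed

lemma submatrix_eqI:
  assumes A: "A \<in> carrier_mat n n'" and I: "I \<subseteq> {..<n}" and J: "J \<subseteq> {..<n'}"
    and B: "B \<in> carrier_mat (card I) (card J)"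
    and entry: "\<And>i j. i < card I \<Longrightarrow> j < card J \<Longrightarrow> A $$ (pick I i, pick J j) = B $$ (i,j)"
  shows "submatrix A I J = B"
  by (rule eq_matI) (use submatrix_carrier[OF A I J] B in
      \<open>auto simp: submatrix_entry[OF A I J] entry\<close>)

lemma pick_eq_iff:
  assumes "i < card I" "j < card I"
  shows "pick I i = pick I j \<longleftrightarrow> i = j"
  by (metis assms card_pick_le)

lemma bij_betw_pick:
  assumes "finite I"
  shows "bij_betw (pick I) {..<card I} I"
proof (rule bij_betw_imageI)
  show inj: "inj_on (pick I) {..<card I}"
    by (rule inj_onI) (metis card_pick_le lessThan_iff)
  show "pick I ` {..<card I} = I"
  proof (rule card_subset_eq[OF assms])
    show "pick I ` {..<card I} \<subseteq> I" using pick_in_set_le by auto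
    show "card (pick I ` {..<card I}) = card I" using card_image[OF inj] by simp
  qed
qed

text \<open>
  A block is indexed through \<open>pick\<close>, so every sum over an index set inside a block product is first
  turned by this rule into a sum over the set itself.
\<close>

lemma sum_pick:
  assumes "finite I"
  shows "(\<Sum>k<card I. f (pick I k)) = sum f I"
  using sum.reindex_bij_betw[OF bij_betw_pick[OF assms], of f] .

lemma mat_mult_entry:
  assumes "A \<in> carrier_mat n m" "B \<in> carrier_mat m k" "i < n" "j < k"
  shows "(A * B) $$ (i,j) = (\<Sum>l<m. A $$ (i,l) * B $$ (l,j))"
  using assms by (auto simp: scalar_prod_def lessThan_atLeast0 intro!: sum.cong)

text \<open>
  Splitting the inner summation index along \<open>C\<close> and \<open>D\<close> gives the usual product rule for \<open>2 \<times> 2\<close>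
  block matrices.
\<close>

lemma submatrix_mult:
  fixes A B :: "complex mat"
  assumes A: "A \<in> carrier_mat n n" and B: "B \<in> carrier_mat n n"
    and CD: "C \<union> D = {..<n}" "C \<inter> D = {}" and I: "I \<subseteq> {..<n}" and J: "J \<subseteq> {..<n}"
  shows "submatrix (A * B) I J
    = submatrix A I C * submatrix B C J + submatrix A I D * submatrix B D J"
proof -
  have C: "C \<subseteq> {..<n}" and D: "D \<subseteq> {..<n}" using CD by auto
  have fin: "finite C" "finite D" using C D finite_subset by blast+
  note cs = submatrix_carrier[OF A I C] submatrix_carrier[OF B C J]
    submatrix_carrier[OF A I D] submatrix_carrier[OF B D J]
  have AB: "A * B \<in> carrier_mat n n" using A B by simp
  show ?thesis
  proof (rule eq_matI)
    fix i j
    assume "i < dim_row (submatrix A I C * submatrix B C J + submatrix A I D * submatrix B D J)"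
      "j < dim_col (submatrix A I C * submatrix B C J + submatrix A I D * submatrix B D J)"
    then have i: "i < card I" and j: "j < card J" using cs by auto
    have pi: "pick I i < n" and pj: "pick J j < n" using pick_in_set_le i j I J by blast+
    have "submatrix (A * B) I J $$ (i,j) = (\<Sum>l<n. A $$ (pick I i,l) * B $$ (l,pick J j))"
      by (simp add: submatrix_entry[OF AB I J i j] mat_mult_entry[OF A B pi pj])
    also have "\<dots> = (\<Sum>l\<in>C. A $$ (pick I i,l) * B $$ (l,pick J j))
        + (\<Sum>l\<in>D. A $$ (pick I i,l) * B $$ (l,pick J j))"
      by (simp add: CD(1)[symmetric] sum.union_disjoint[OF fin CD(2)])
    also have "(\<Sum>l\<in>C. A $$ (pick I i,l) * B $$ (l,pick J j))
        = (submatrix A I C * submatrix B C J) $$ (i,j)"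
      by (simp add: mat_mult_entry[OF cs(1,2) i j] sum_pick[OF fin(1), symmetric]
          submatrix_entry[OF A I C i] submatrix_entry[OF B C J _ j])
    also have "(\<Sum>l\<in>D. A $$ (pick I i,l) * B $$ (l,pick J j))
        = (submatrix A I D * submatrix B D J) $$ (i,j)"
      by (simp add: mat_mult_entry[OF cs(3,4) i j] sum_pick[OF fin(2), symmetric]
          submatrix_entry[OF A I D i] submatrix_entry[OF B D J _ j])
    finally show "submatrix (A * B) I J $$ (i,j)
        = (submatrix A I C * submatrix B C J + submatrix A I D * submatrix B D J) $$ (i,j)"
      using i j cs by auto
  qed (use cs submatrix_carrier[OF AB I J] in auto)
qed

section \<open>Adjoints and inverses\<close>

lemma mat_adjoint_carrier:
  assumes "A \<in> carrier_mat n m"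
  shows "mat_adjoint A \<in> carrier_mat m n"
  using assms by (auto simp: mat_adjoint_def)

lemma mat_adjoint_entry:
  fixes A :: "complex mat"
  assumes "A \<in> carrier_mat n m" "i < m" "j < n"
  shows "mat_adjoint A $$ (i,j) = cnj (A $$ (j,i))"
  using assms by (auto simp: mat_adjoint_def mat_of_rows_def)

lemma mat_adjoint_mult:
  fixes A B :: "complex mat"
  assumes A: "A \<in> carrier_mat n m" and B: "B \<in> carrier_mat m k"
  shows "mat_adjoint (A * B) = mat_adjoint B * mat_adjoint A"
proof (rule eq_matI)
  have AB: "A * B \<in> carrier_mat n k" using A B by simp
  note adj = mat_adjoint_carrier[OF A] mat_adjoint_carrier[OF B] mat_adjoint_carrier[OF AB]
  show "dim_row (mat_adjoint (A * B)) = dim_row (mat_adjoint B * mat_adjoint A)"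
    "dim_col (mat_adjoint (A * B)) = dim_col (mat_adjoint B * mat_adjoint A)"
    using adj by auto
  fix i j assume "i < dim_row (mat_adjoint B * mat_adjoint A)" "j < dim_col (mat_adjoint B * mat_adjoint A)"
  then have i: "i < k" and j: "j < n" using adj by auto
  show "mat_adjoint (A * B) $$ (i,j) = (mat_adjoint B * mat_adjoint A) $$ (i,j)"
    by (simp add: mat_adjoint_entry[OF AB i j] mat_mult_entry[OF A B j i] mat_mult_entry[OF adj(2,1) i j]
        mat_adjoint_entry[OF A _ j] mat_adjoint_entry[OF B i] mult.commute)
qed

lemma submatrix_mat_adjoint:
  fixes A :: "complex mat"
  assumes A: "A \<in> carrier_mat n n" and I: "I \<subseteq> {..<n}" and J: "J \<subseteq> {..<n}"
  shows "submatrix (mat_adjoint A) I J = mat_adjoint (submatrix A J I)"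
proof (rule eq_matI)
  note A' = mat_adjoint_carrier[OF A]
  note c = submatrix_carrier[OF A' I J] mat_adjoint_carrier[OF submatrix_carrier[OF A J I]]
  show "dim_row (submatrix (mat_adjoint A) I J) = dim_row (mat_adjoint (submatrix A J I))"
    "dim_col (submatrix (mat_adjoint A) I J) = dim_col (mat_adjoint (submatrix A J I))"
    using c by auto
  fix i j assume "i < dim_row (mat_adjoint (submatrix A J I))" "j < dim_col (mat_adjoint (submatrix A J I))"
  then have i: "i < card I" and j: "j < card J" using c by auto
  have "pick I i < n" "pick J j < n" using pick_in_set_le i j I J by blast+
  then show "submatrix (mat_adjoint A) I J $$ (i,j) = mat_adjoint (submatrix A J I) $$ (i,j)"
    by (simp add: submatrix_entry[OF A' I J i j] submatrix_entry[OF A J I j i] mat_adjoint_entry[OF A]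
        mat_adjoint_entry[OF submatrix_carrier[OF A J I] i j])
qed

lemma invertible_mat_rightI:
  fixes A X :: "complex mat"
  assumes A: "A \<in> carrier_mat k k" and X: "X \<in> carrier_mat k k" and AX: "A * X = 1\<^sub>m k"
  shows "invertible_mat A"
  using assms mat_mult_left_right_inverse[OF A X AX]
  by (auto simp: invertible_mat_def inverts_mat_def intro!: exI[of _ X])

lemma mat_inv_unique:
  assumes A: "A \<in> carrier_mat k k" and X: "X \<in> carrier_mat k k" and AX: "A * X = 1\<^sub>m k"
  shows "mat_inv A = X"
proof -
  note inv = mat_inv[OF A invertible_mat_rightI[OF A X AX]]
  have "mat_inv A = mat_inv A * (A * X)" using AX inv by simp
  also have "\<dots> = (mat_inv A * A) * X" using assoc_mult_mat[OF inv(1) A X] by simp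
  finally show ?thesis using inv X by simp
qed

text \<open>
  Cramer's rule: it exhibits the entries of the inverse as quotients of polynomials in the entries of
  the matrix, which is how convergence passes to inverses below.
\<close>

lemma mat_inv_adj_mat:
  assumes A: "A \<in> carrier_mat k k" and det: "det A \<noteq> 0"
  shows "invertible_mat A" "mat_inv A = inverse (det A) \<cdot>\<^sub>m adj_mat A"
proof -
  have X: "inverse (det A) \<cdot>\<^sub>m adj_mat A \<in> carrier_mat k k" using adj_mat(1)[OF A] by simp
  have "A * (inverse (det A) \<cdot>\<^sub>m adj_mat A) = inverse (det A) \<cdot>\<^sub>m (A * adj_mat A)"
    using mult_smult_distrib[OF A adj_mat(1)[OF A]] .
  also have "\<dots> = 1\<^sub>m k" unfolding adj_mat(2)[OF A] by (rule eq_matI) (use det in auto)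
  finally have AX: "A * (inverse (det A) \<cdot>\<^sub>m adj_mat A) = 1\<^sub>m k" .
  show "invertible_mat A" "mat_inv A = inverse (det A) \<cdot>\<^sub>m adj_mat A"
    using invertible_mat_rightI[OF A X AX] mat_inv_unique[OF A X AX] .
qed

lemma det_nonzero_of_invertible:
  fixes A :: "complex mat"
  assumes A: "A \<in> carrier_mat k k" and inv: "invertible_mat A"
  shows "det A \<noteq> 0"
  using det_mult[OF A mat_inv(1)[OF A inv]] mat_inv(2)[OF A inv] by auto

lemma invertible_mat_mult:
  fixes A B :: "complex mat"
  assumes A: "A \<in> carrier_mat k k" and B: "B \<in> carrier_mat k k"
    and "invertible_mat A" "invertible_mat B"
  shows "invertible_mat (A * B)"
proof (rule mat_inv_adj_mat(1))
  show "A * B \<in> carrier_mat k k" using A B by simp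
  show "det (A * B) \<noteq> 0"
    unfolding det_mult[OF A B] using assms by (simp add: det_nonzero_of_invertible[of _ k])
qed

lemma mat_adjoint_zero: "mat_adjoint (0\<^sub>m n m :: complex mat) = 0\<^sub>m m n"
proof -
  have "mat_adjoint (0\<^sub>m n m :: complex mat) \<in> carrier_mat m n"
    by (rule mat_adjoint_carrier) simp
  then show ?thesis
    by (intro eq_matI) (auto simp: mat_adjoint_entry[of "0\<^sub>m n m" n m])
qed

lemma mat_adjoint_one: "mat_adjoint (1\<^sub>m n :: complex mat) = 1\<^sub>m n"
proof -
  have "mat_adjoint (1\<^sub>m n :: complex mat) \<in> carrier_mat n n"
    by (rule mat_adjoint_carrier) simp
  then show ?thesis
    by (intro eq_matI) (auto simp: mat_adjoint_entry[of "1\<^sub>m n" n n])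
qed

lemma invertible_mat_adjoint:
  fixes A :: "complex mat"
  assumes A: "A \<in> carrier_mat k k" and inv: "invertible_mat A"
  shows "invertible_mat (mat_adjoint A)"
proof (rule invertible_mat_rightI[OF mat_adjoint_carrier[OF A] mat_adjoint_carrier[OF mat_inv(1)[OF A inv]]])
  show "mat_adjoint A * mat_adjoint (mat_inv A) = 1\<^sub>m k"
    using mat_adjoint_mult[OF mat_inv(1)[OF A inv] A] mat_inv(3)[OF A inv]
    by (simp add: mat_adjoint_one)
qed

section \<open>Schur complements under block triangular congruence\<close>

text \<open>
  A solution \<open>X\<close> of \<open>M\<^sub>C\<^sub>C X = M\<^sub>C\<^sub>D\<close> replaces the inverse of \<open>M\<^sub>C\<^sub>C\<close>, so that a Schur complement can
  be computed by guessing \<open>X\<close>.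
\<close>

lemma schur_compl_eqI:
  assumes M: "M \<in> carrier_mat n n" and C: "C \<subseteq> {..<n}" and D: "D \<subseteq> {..<n}"
    and inv: "invertible_mat (submatrix M C C)"
    and X: "X \<in> carrier_mat (card C) (card D)" and eq: "submatrix M C C * X = submatrix M C D"
  shows "schur_compl M C D = submatrix M D D - submatrix M D C * X"
proof -
  note a = submatrix_carrier[OF M C C]
  note ai = mat_inv[OF a inv]
  have "submatrix M D C * mat_inv (submatrix M C C) * submatrix M C D
      = submatrix M D C * (mat_inv (submatrix M C C) * (submatrix M C C * X))"
    using assoc_mult_mat[OF submatrix_carrier[OF M D C] ai(1) submatrix_carrier[OF M C D]] eq by simp
  also have "mat_inv (submatrix M C C) * (submatrix M C C * X) = X"
    using assoc_mult_mat[OF ai(1) a X] ai(3) X by simp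
  finally show ?thesis unfolding schur_compl_def by simp
qed

lemma schur_compl_carrier:
  assumes M: "M \<in> carrier_mat n n" and D: "D \<subseteq> {..<n}"
  shows "schur_compl M C D \<in> carrier_mat (card D) (card D)"
  using submatrix_carrier[OF M D D] by (intro carrier_matI) (auto simp: schur_compl_def dim_submatrix)

text \<open>
  The matrix algebra rules restated with equations between dimensions as premises.  Unlike membership in
  \<open>carrier_mat\<close> with unknown dimensions, these are decided by the simplifier alone.
\<close>

lemma mat_zero_dim:
  fixes X :: "complex mat"
  shows "\<lbrakk>dim_row X = n; dim_col X = m\<rbrakk> \<Longrightarrow> X + 0\<^sub>m n m = X"
    and "dim_row X = m \<Longrightarrow> 0\<^sub>m n m * X = 0\<^sub>m n (dim_col X)"
    and "dim_col X = m \<Longrightarrow> X * 0\<^sub>m m n = 0\<^sub>m (dim_row X) n"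
  by (auto intro: right_add_zero_mat left_mult_zero_mat right_mult_zero_mat)

lemma mat_assoc_dim:
  fixes X Y Z :: "complex mat"
  assumes "dim_col X = dim_row Y" "dim_col Y = dim_row Z"
  shows "(X * Y) * Z = X * (Y * Z)"
  using assms by (intro assoc_mult_mat[of _ "dim_row X" "dim_row Y" _ "dim_row Z" _ "dim_col Z"]) auto

lemma mat_distrib_dim:
  fixes X Y Z :: "complex mat"
  shows "\<lbrakk>dim_col X = dim_row Y; dim_row Y = dim_row Z; dim_col Y = dim_col Z\<rbrakk>
      \<Longrightarrow> X * (Y + Z) = X * Y + X * Z"
    and "\<lbrakk>dim_col X = dim_row Z; dim_row X = dim_row Y; dim_col X = dim_col Y\<rbrakk>
      \<Longrightarrow> (X + Y) * Z = X * Z + Y * Z"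
    and "\<lbrakk>dim_col X = dim_row Y; dim_row Y = dim_row Z; dim_col Y = dim_col Z\<rbrakk>
      \<Longrightarrow> X * (Y - Z) = X * Y - X * Z"
    and "\<lbrakk>dim_col X = dim_row Z; dim_row X = dim_row Y; dim_col X = dim_col Y\<rbrakk>
      \<Longrightarrow> (X - Y) * Z = X * Z - Y * Z"
     apply (rule mult_add_distrib_mat[of _ "dim_row X" "dim_row Y" _ "dim_col Y"]; auto)
    apply (rule add_mult_distrib_mat[of _ "dim_row X" "dim_row Z"]; auto)
   apply (rule mult_minus_distrib_mat[of _ "dim_row X" "dim_row Y" _ "dim_col Y"]; auto)
  apply (rule minus_mult_distrib_mat[of _ "dim_row X" "dim_row Z"]; auto)
  done

text \<open>
  Writing \<open>L\<close> with diagonal blocks \<open>p\<close>, \<open>s\<close> and lower left block \<open>r\<close>, the \<open>C\<close> rows of \<open>L M\<close> are \<open>p\<close>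
  times those of \<open>M\<close>, while \<open>r\<close> adds multiples of the \<open>C\<close> rows to the \<open>D\<close> rows.  Block elimination
  removes exactly such multiples, hence \<open>r\<close> drops out of the Schur complement, and so does the change of
  basis \<open>p\<close> of the eliminated block; only \<open>s\<close> is left.  If \<open>X\<close> solves
  \<open>M\<^sub>C\<^sub>C X = M\<^sub>C\<^sub>D\<close>, the corresponding solution for \<open>L M L\<^sup>H\<close> is \<open>p\<^sup>-\<^sup>H (r\<^sup>H + X s\<^sup>H)\<close>.
\<close>

lemma schur_compl_congruence:
  assumes M: "M \<in> carrier_mat n n" and L: "L \<in> carrier_mat n n"
    and CD: "C \<union> D = {..<n}" "C \<inter> D = {}"
    and L0: "submatrix L C D = 0\<^sub>m (card C) (card D)"
    and invL: "invertible_mat (submatrix L C C)" and invM: "invertible_mat (submatrix M C C)"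
  defines "G \<equiv> L * M * mat_adjoint L"
  shows "invertible_mat (submatrix G C C)"
    and "schur_compl G C D
      = submatrix L D D * schur_compl M C D * mat_adjoint (submatrix L D D)"
proof -
  have C: "C \<subseteq> {..<n}" and D: "D \<subseteq> {..<n}" using CD by auto
  define a b c d where "a = submatrix M C C" and "b = submatrix M C D"
    and "c = submatrix M D C" and "d = submatrix M D D"
  define p r s where "p = submatrix L C C" and "r = submatrix L D C" and "s = submatrix L D D"
  define p' r' s' where "p' = mat_adjoint p" and "r' = mat_adjoint r" and "s' = mat_adjoint s"
  define X where "X = mat_inv a * b"
  define q where "q = mat_inv p'"
  note defs = a_def b_def c_def d_def p_def r_def s_def
  have cM [simp]: "a \<in> carrier_mat (card C) (card C)" "b \<in> carrier_mat (card C) (card D)"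
      "c \<in> carrier_mat (card D) (card C)" "d \<in> carrier_mat (card D) (card D)"
    and cL [simp]: "p \<in> carrier_mat (card C) (card C)" "r \<in> carrier_mat (card D) (card C)"
      "s \<in> carrier_mat (card D) (card D)"
    unfolding defs using M L C D by (simp_all add: submatrix_carrier)
  have cL' [simp]: "p' \<in> carrier_mat (card C) (card C)" "r' \<in> carrier_mat (card C) (card D)"
      "s' \<in> carrier_mat (card D) (card D)"
    unfolding p'_def r'_def s'_def by (auto intro: mat_adjoint_carrier)
  have inva: "invertible_mat a" and invp: "invertible_mat p" using invM invL by (simp_all add: defs)
  have invp': "invertible_mat p'" unfolding p'_def by (rule invertible_mat_adjoint[OF cL(1) invp])
  note ai = mat_inv[OF cM(1) inva]
  note qi = mat_inv[OF cL'(1) invp', folded q_def]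
  have cX [simp]: "X \<in> carrier_mat (card C) (card D)" unfolding X_def using ai(1) by simp
  have aX: "a * X = b"
    unfolding X_def using assoc_mult_mat[OF cM(1) ai(1) cM(2)] ai(2) left_mult_one_mat[OF cM(2)] by simp
  have LM: "L * M \<in> carrier_mat n n" and L': "mat_adjoint L \<in> carrier_mat n n"
    using L M mat_adjoint_carrier by auto
  then have G: "G \<in> carrier_mat n n" unfolding G_def by simp
  have adj: "submatrix (mat_adjoint L) C C = p'" "submatrix (mat_adjoint L) C D = r'"
    "submatrix (mat_adjoint L) D D = s'" "submatrix (mat_adjoint L) D C = 0\<^sub>m (card D) (card C)"
    by (simp_all add: mat_adjoint_zero submatrix_mat_adjoint[OF L] C D L0 p'_def r'_def s'_def defs)
  note dims = cM[unfolded carrier_mat_def] cL[unfolded carrier_mat_def]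
    cL'[unfolded carrier_mat_def] cX[unfolded carrier_mat_def] qi(1)[unfolded carrier_mat_def]
  have dims [simp]: "dim_row a = card C" "dim_col a = card C" "dim_row b = card C" "dim_col b = card D"
    "dim_row c = card D" "dim_col c = card C" "dim_row d = card D" "dim_col d = card D"
    "dim_row p = card C" "dim_col p = card C" "dim_row r = card D" "dim_col r = card C"
    "dim_row s = card D" "dim_col s = card D"
    "dim_row p' = card C" "dim_col p' = card C" "dim_row r' = card C" "dim_col r' = card D"
    "dim_row s' = card D" "dim_col s' = card D"
    "dim_row X = card C" "dim_col X = card D" "dim_row q = card C" "dim_col q = card C"
    using dims by auto
  have LMb: "submatrix (L * M) C C = p * a" "submatrix (L * M) C D = p * b"
    "submatrix (L * M) D C = r * a + s * c" "submatrix (L * M) D D = r * b + s * d"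
    by (simp_all add: submatrix_mult[OF L M CD] C D L0 defs[symmetric] mat_zero_dim)
  have Gb: "submatrix G C C = p * a * p'" "submatrix G C D = p * a * r' + p * b * s'"
    "submatrix G D C = (r * a + s * c) * p'"
    "submatrix G D D = (r * a + s * c) * r' + (r * b + s * d) * s'"
    unfolding G_def
    by (simp_all add: submatrix_mult[OF LM L' CD] C D LMb adj mat_zero_dim)
  show invG: "invertible_mat (submatrix G C C)"
    unfolding Gb(1) by (intro invertible_mat_mult[of _ "card C"] inva invp invp') auto
  \<comment> \<open>\<open>q * Y\<close> solves the equation of \<open>schur_compl_eqI\<close> for \<open>G\<close>.\<close>
  define Y where "Y = r' + X * s'"
  have Y: "Y \<in> carrier_mat (card C) (card D)" unfolding Y_def by (rule carrier_matI) simp_all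
  have p'q: "p' * (q * Y) = Y"
    using mat_assoc_dim[of p' q Y] qi(2) Y by auto
  have eq: "submatrix G C C * (q * Y) = submatrix G C D"
  proof -
    have "submatrix G C C * (q * Y) = p * (a * Y)"
      unfolding Gb using Y p'q by (simp add: mat_assoc_dim)
    also have "a * Y = a * r' + b * s'"
      unfolding Y_def aX[symmetric] by (simp add: mat_distrib_dim mat_assoc_dim)
    also have "p * \<dots> = submatrix G C D"
      unfolding Gb by (simp add: mat_distrib_dim mat_assoc_dim)
    finally show ?thesis .
  qed
  have "schur_compl G C D = submatrix G D D - submatrix G D C * (q * Y)"
    by (rule schur_compl_eqI[OF G C D invG _ eq]) (use qi Y in auto)
  also have "submatrix G D C * (q * Y) = (r * a + s * c) * Y"
    unfolding Gb using Y p'q by (simp add: mat_assoc_dim)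
  also have "\<dots> = r * a * r' + r * b * s' + s * c * r' + s * c * X * s'"
    unfolding Y_def aX[symmetric]
    by (rule eq_matI) (simp_all add: mat_distrib_dim mat_assoc_dim del: index_mult_mat(1))
  also have "submatrix G D D - \<dots> = s * (d - c * X) * s'"
    unfolding Gb
    by (rule eq_matI) (simp_all add: mat_distrib_dim mat_assoc_dim del: index_mult_mat(1))
  also have "d - c * X = schur_compl M C D"
    using schur_compl_eqI[OF M C D invM cX, folded a_def b_def c_def d_def] aX by (simp add: defs)
  finally show "schur_compl G C D
      = submatrix L D D * schur_compl M C D * mat_adjoint (submatrix L D D)"
    by (simp add: s'_def s_def)
qed

section \<open>Convergence with rate \<open>1/b\<close>\<close>

text \<open>
  The comparison function is complex because both functions in a Landau relation must have the same
  codomain.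
\<close>

definition O_close :: "(real \<Rightarrow> complex) \<Rightarrow> complex \<Rightarrow> bool" where
  "O_close f c \<longleftrightarrow> (\<lambda>b. f b - c) \<in> O[at_top](\<lambda>b. inverse (complex_of_real b))"

lemma inverse_of_real_smallo_1: "(\<lambda>b. inverse (complex_of_real b)) \<in> o[at_top](\<lambda>_. 1)"
proof (rule smalloI_tendsto)
  have "((\<lambda>b. complex_of_real (inverse b)) \<longlongrightarrow> complex_of_real 0) at_top"
    by (intro tendsto_of_real tendsto_inverse_0_at_top filterlim_ident)
  then show "((\<lambda>b. inverse (complex_of_real b) / 1) \<longlongrightarrow> 0) at_top" by simp
qed simp

lemma O_close_tendsto:
  assumes "O_close f c"
  shows "(f \<longlongrightarrow> c) at_top"
proof -
  have "(\<lambda>b. f b - c) \<in> o[at_top](\<lambda>_. 1)"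
    using landau_o.big_small_trans[OF assms[unfolded O_close_def] inverse_of_real_smallo_1] .
  from smalloD_tendsto[OF this] show ?thesis by (simp add: LIM_zero_iff)
qed

lemma O_close_bounded:
  assumes "O_close f c"
  shows "f \<in> O[at_top](\<lambda>_. 1)"
  by (rule bigoI_tendsto[where c = c]) (use O_close_tendsto[OF assms] in simp_all)

lemma O_close_const: "O_close (\<lambda>_. c) c"
  by (simp add: O_close_def)

lemma O_close_cong:
  assumes "\<forall>\<^sub>F b in at_top. f b = g b"
  shows "O_close f c \<longleftrightarrow> O_close g c"
  unfolding O_close_def
  by (rule landau_o.big.in_cong) (use assms in eventually_elim, simp)

lemma O_close_add:
  assumes "O_close f c" "O_close g d"
  shows "O_close (\<lambda>b. f b + g b) (c + d)"
  using sum_in_bigo(1)[OF assms[unfolded O_close_def]] by (simp add: O_close_def algebra_simps)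

lemma O_close_diff:
  assumes "O_close f c" "O_close g d"
  shows "O_close (\<lambda>b. f b - g b) (c - d)"
  using sum_in_bigo(2)[OF assms[unfolded O_close_def]] by (simp add: O_close_def algebra_simps)

lemma O_close_mult:
  assumes f: "O_close f c" and g: "O_close g d"
  shows "O_close (\<lambda>b. f b * g b) (c * d)"
proof -
  have "(\<lambda>b. f b * (g b - d)) \<in> O[at_top](\<lambda>b. inverse (complex_of_real b))"
    using landau_o.big_mult[OF O_close_bounded[OF f] g[unfolded O_close_def]] by simp
  moreover have "(\<lambda>b. (f b - c) * d) \<in> O[at_top](\<lambda>b. inverse (complex_of_real b))"
    using f unfolding O_close_def by simp
  ultimately have "(\<lambda>b. f b * (g b - d) + (f b - c) * d) \<in> O[at_top](\<lambda>b. inverse (complex_of_real b))"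
    by (rule sum_in_bigo(1))
  then show ?thesis by (simp add: O_close_def algebra_simps)
qed

lemma O_close_cnj:
  assumes "O_close f c"
  shows "O_close (\<lambda>b. cnj (f b)) (cnj c)"
proof -
  have "(\<lambda>b. cnj (f b - c)) \<in> O[at_top](\<lambda>b. inverse (complex_of_real b))"
    using assms unfolding O_close_def
    by (subst landau_o.big.norm_iff[symmetric], subst complex_mod_cnj, subst landau_o.big.norm_iff)
  then show ?thesis by (simp add: O_close_def)
qed

lemma O_close_sum:
  assumes "\<And>i. i \<in> I \<Longrightarrow> O_close (f i) (c i)"
  shows "O_close (\<lambda>b. \<Sum>i\<in>I. f i b) (\<Sum>i\<in>I. c i)"
  using assms by (induction I rule: infinite_finite_induct) (auto intro: O_close_const O_close_add)

lemma O_close_prod: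
  assumes "\<And>i. i \<in> I \<Longrightarrow> O_close (f i) (c i)"
  shows "O_close (\<lambda>b. \<Prod>i\<in>I. f i b) (\<Prod>i\<in>I. c i)"
  using assms by (induction I rule: infinite_finite_induct) (auto intro: O_close_const O_close_mult)

text \<open>
  Near a nonzero limit \<open>1/f\<close> stays bounded, and \<open>1/f - 1/c = - (f - c) / (c f)\<close>.
\<close>

lemma O_close_inverse:
  assumes f: "O_close f c" and c: "c \<noteq> 0"
  shows "O_close (\<lambda>b. inverse (f b)) (inverse c)"
proof -
  have nz: "\<forall>\<^sub>F b in at_top. f b \<noteq> 0"
    using tendsto_imp_eventually_ne[OF O_close_tendsto[OF f] c] .
  have "((\<lambda>b. inverse (f b)) \<longlongrightarrow> inverse c) at_top"
    using tendsto_inverse[OF O_close_tendsto[OF f] c] .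
  then have "(\<lambda>b. inverse (f b)) \<in> O[at_top](\<lambda>_. 1)"
    by (intro bigoI_tendsto[where c = "inverse c"]) simp_all
  from landau_o.big_mult[OF this f[unfolded O_close_def]]
  have "(\<lambda>b. - inverse c * (inverse (f b) * (f b - c))) \<in> O[at_top](\<lambda>b. inverse (complex_of_real b))"
    using c by simp
  moreover have "\<forall>\<^sub>F b in at_top. - inverse c * (inverse (f b) * (f b - c)) = inverse (f b) - inverse c"
    using nz by eventually_elim (use c in \<open>simp add: field_simps\<close>)
  ultimately show ?thesis unfolding O_close_def using landau_o.big.in_cong by metis
qed

text \<open>
  The dimensions are prescribed for large \<open>b\<close> only, since \<open>mat_inv\<close> is unspecified on the singular
  matrices that may occur for small \<open>b\<close>.
\<close>

definition mat_O_close :: "nat \<Rightarrow> nat \<Rightarrow> (real \<Rightarrow> complex mat) \<Rightarrow> complex mat \<Rightarrow> bool" where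
  "mat_O_close n m F M \<longleftrightarrow>
     M \<in> carrier_mat n m \<and> (\<forall>\<^sub>F b in at_top. F b \<in> carrier_mat n m) \<and>
     (\<forall>i<n. \<forall>j<m. O_close (\<lambda>b. F b $$ (i,j)) (M $$ (i,j)))"

lemma mat_O_closeD:
  assumes "mat_O_close n m F M"
  shows "M \<in> carrier_mat n m" "\<forall>\<^sub>F b in at_top. F b \<in> carrier_mat n m"
    "\<And>i j. i < n \<Longrightarrow> j < m \<Longrightarrow> O_close (\<lambda>b. F b $$ (i,j)) (M $$ (i,j))"
  using assms by (auto simp: mat_O_close_def)

text \<open>
  Matrix operations have their expected entries only where the dimensions are right, that is, eventually;
  \<open>e\<close> is the formula for the entries that holds there.
\<close>

lemma mat_O_closeI:
  assumes M: "M \<in> carrier_mat n m" and F: "\<forall>\<^sub>F b in at_top. F b \<in> carrier_mat n m"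
    and entry: "\<And>i j. i < n \<Longrightarrow> j < m \<Longrightarrow> O_close (\<lambda>b. e i j b) (M $$ (i,j))"
    and eq: "\<And>i j. i < n \<Longrightarrow> j < m \<Longrightarrow> \<forall>\<^sub>F b in at_top. F b $$ (i,j) = e i j b"
  shows "mat_O_close n m F M"
  unfolding mat_O_close_def using M F entry O_close_cong[OF eq] by simp

lemma mat_O_close_cong:
  assumes "\<forall>\<^sub>F b in at_top. F b = F' b"
  shows "mat_O_close n m F M \<longleftrightarrow> mat_O_close n m F' M"
proof -
  have "(\<forall>\<^sub>F b in at_top. F b \<in> carrier_mat n m) \<longleftrightarrow> (\<forall>\<^sub>F b in at_top. F' b \<in> carrier_mat n m)"
    by (rule eventually_cong[OF assms]) simp
  moreover have "O_close (\<lambda>b. F b $$ (i,j)) c \<longleftrightarrow> O_close (\<lambda>b. F' b $$ (i,j)) c" for i j c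
    by (rule O_close_cong) (use assms in eventually_elim, simp)
  ultimately show ?thesis unfolding mat_O_close_def by simp
qed

lemma mat_O_close_const:
  assumes "M \<in> carrier_mat n m"
  shows "mat_O_close n m (\<lambda>_. M) M"
  using assms by (auto simp: mat_O_close_def O_close_const)

lemma mat_O_close_diff:
  assumes F: "mat_O_close n m F M" and G: "mat_O_close n m G N"
  shows "mat_O_close n m (\<lambda>b. F b - G b) (M - N)"
proof (rule mat_O_closeI[where e = "\<lambda>i j b. F b $$ (i,j) - G b $$ (i,j)"])
  show "M - N \<in> carrier_mat n m" by (rule minus_carrier_mat[OF mat_O_closeD(1)[OF G]])
  show "\<forall>\<^sub>F b in at_top. F b - G b \<in> carrier_mat n m"
    using mat_O_closeD(2)[OF G] by eventually_elim (rule minus_carrier_mat)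
  fix i j assume ij: "i < n" "j < m"
  show "\<forall>\<^sub>F b in at_top. (F b - G b) $$ (i,j) = F b $$ (i,j) - G b $$ (i,j)"
    using mat_O_closeD(2)[OF F] mat_O_closeD(2)[OF G] by eventually_elim (use ij in auto)
  show "O_close (\<lambda>b. F b $$ (i,j) - G b $$ (i,j)) ((M - N) $$ (i,j))"
    using O_close_diff[OF mat_O_closeD(3)[OF F ij] mat_O_closeD(3)[OF G ij]] ij
      mat_O_closeD(1)[OF F] mat_O_closeD(1)[OF G] by auto
qed

lemma mat_O_close_mult:
  assumes F: "mat_O_close n m F M" and G: "mat_O_close m k G N"
  shows "mat_O_close n k (\<lambda>b. F b * G b) (M * N)"
proof (rule mat_O_closeI[where e = "\<lambda>i j b. \<Sum>l<m. F b $$ (i,l) * G b $$ (l,j)"])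
  note M = mat_O_closeD(1)[OF F] and N = mat_O_closeD(1)[OF G]
  show "M * N \<in> carrier_mat n k" using M N by simp
  show "\<forall>\<^sub>F b in at_top. F b * G b \<in> carrier_mat n k"
    using mat_O_closeD(2)[OF F] mat_O_closeD(2)[OF G] by eventually_elim simp
  fix i j assume ij: "i < n" "j < k"
  show "\<forall>\<^sub>F b in at_top. (F b * G b) $$ (i,j) = (\<Sum>l<m. F b $$ (i,l) * G b $$ (l,j))"
    using mat_O_closeD(2)[OF F] mat_O_closeD(2)[OF G]
    by eventually_elim (rule mat_mult_entry[OF _ _ ij])
  show "O_close (\<lambda>b. \<Sum>l<m. F b $$ (i,l) * G b $$ (l,j)) ((M * N) $$ (i,j))"
    unfolding mat_mult_entry[OF M N ij]
    by (intro O_close_sum O_close_mult mat_O_closeD(3)[OF F] mat_O_closeD(3)[OF G]) (use ij in auto)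
qed

lemma mat_O_close_adjoint:
  assumes F: "mat_O_close n m F M"
  shows "mat_O_close m n (\<lambda>b. mat_adjoint (F b)) (mat_adjoint M)"
proof (rule mat_O_closeI[where e = "\<lambda>i j b. cnj (F b $$ (j,i))"])
  note M = mat_O_closeD(1)[OF F]
  show "mat_adjoint M \<in> carrier_mat m n" using mat_adjoint_carrier[OF M] .
  show "\<forall>\<^sub>F b in at_top. mat_adjoint (F b) \<in> carrier_mat m n"
    using mat_O_closeD(2)[OF F] by eventually_elim (rule mat_adjoint_carrier)
  fix i j assume ij: "i < m" "j < n"
  show "\<forall>\<^sub>F b in at_top. mat_adjoint (F b) $$ (i,j) = cnj (F b $$ (j,i))"
    using mat_O_closeD(2)[OF F] by eventually_elim (rule mat_adjoint_entry[OF _ ij])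
  show "O_close (\<lambda>b. cnj (F b $$ (j,i))) (mat_adjoint M $$ (i,j))"
    unfolding mat_adjoint_entry[OF M ij] by (intro O_close_cnj mat_O_closeD(3)[OF F] ij)
qed

lemma mat_O_close_submatrix:
  assumes F: "mat_O_close n m F M" and I: "I \<subseteq> {..<n}" and J: "J \<subseteq> {..<m}"
  shows "mat_O_close (card I) (card J) (\<lambda>b. submatrix (F b) I J) (submatrix M I J)"
proof (rule mat_O_closeI[where e = "\<lambda>i j b. F b $$ (pick I i, pick J j)"])
  note M = mat_O_closeD(1)[OF F]
  show "submatrix M I J \<in> carrier_mat (card I) (card J)" using submatrix_carrier[OF M I J] .
  show "\<forall>\<^sub>F b in at_top. submatrix (F b) I J \<in> carrier_mat (card I) (card J)"
    using mat_O_closeD(2)[OF F] by eventually_elim (rule submatrix_carrier[OF _ I J])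
  fix i j assume ij: "i < card I" "j < card J"
  show "\<forall>\<^sub>F b in at_top. submatrix (F b) I J $$ (i,j) = F b $$ (pick I i, pick J j)"
    using mat_O_closeD(2)[OF F] by eventually_elim (rule submatrix_entry[OF _ I J ij])
  have "pick I i < n" "pick J j < m" using pick_in_set_le ij I J by blast+
  then show "O_close (\<lambda>b. F b $$ (pick I i, pick J j)) (submatrix M I J $$ (i,j))"
    unfolding submatrix_entry[OF M I J ij] by (rule mat_O_closeD(3)[OF F])
qed

text \<open>
  The determinant is a polynomial in the entries.
\<close>

lemma O_close_det:
  assumes F: "mat_O_close k k F M"
  shows "O_close (\<lambda>b. det (F b)) (det M)"
proof -
  note det = det_def'[of _ k]
  have ev: "\<forall>\<^sub>F b in at_top. det (F b)
      = (\<Sum>p | p permutes {0..<k}. signof p * (\<Prod>i=0..<k. F b $$ (i, p i)))"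
    using mat_O_closeD(2)[OF F] by eventually_elim (rule det)
  have "O_close (\<lambda>b. \<Sum>p | p permutes {0..<k}. signof p * (\<Prod>i=0..<k. F b $$ (i, p i)))
      (\<Sum>p | p permutes {0..<k}. signof p * (\<Prod>i=0..<k. M $$ (i, p i)))"
  proof (intro O_close_sum O_close_mult O_close_const O_close_prod mat_O_closeD(3)[OF F])
    fix p i assume "p \<in> {p. p permutes {0..<k}}" "i \<in> {0..<k}"
    then show "i < k" "p i < k" using permutes_in_image[of p "{0..<k}" i] by auto
  qed
  then show ?thesis unfolding O_close_cong[OF ev] det[OF mat_O_closeD(1)[OF F]] .
qed

lemma mat_O_close_mat_delete:
  assumes F: "mat_O_close k k F M" and ij: "i < k" "j < k"
  shows "mat_O_close (k - 1) (k - 1) (\<lambda>b. mat_delete (F b) i j) (mat_delete M i j)"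
proof (rule mat_O_closeI[where e = "\<lambda>i' j' b.
      F b $$ (if i' < i then i' else Suc i', if j' < j then j' else Suc j')"])
  note M = mat_O_closeD(1)[OF F]
  show "mat_delete M i j \<in> carrier_mat (k - 1) (k - 1)" by (rule mat_delete_carrier[OF M])
  show "\<forall>\<^sub>F b in at_top. mat_delete (F b) i j \<in> carrier_mat (k - 1) (k - 1)"
    using mat_O_closeD(2)[OF F] by eventually_elim (rule mat_delete_carrier)
  fix i' j' assume ij': "i' < k - 1" "j' < k - 1"
  have entry: "mat_delete A i j $$ (i',j')
      = A $$ (if i' < i then i' else Suc i', if j' < j then j' else Suc j')"
    if "A \<in> carrier_mat k k" for A :: "complex mat"
    using that ij' unfolding mat_delete_def by auto
  show "\<forall>\<^sub>F b in at_top. mat_delete (F b) i j $$ (i',j')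
      = F b $$ (if i' < i then i' else Suc i', if j' < j then j' else Suc j')"
    using mat_O_closeD(2)[OF F] by eventually_elim (rule entry)
  show "O_close (\<lambda>b. F b $$ (if i' < i then i' else Suc i', if j' < j then j' else Suc j'))
      (mat_delete M i j $$ (i',j'))"
    unfolding entry[OF M] by (rule mat_O_closeD(3)[OF F]) (use ij' in auto)
qed

lemma mat_O_close_mat_inv:
  assumes F: "mat_O_close k k F M" and inv: "invertible_mat M"
  shows "\<forall>\<^sub>F b in at_top. invertible_mat (F b)"
    and "mat_O_close k k (\<lambda>b. mat_inv (F b)) (mat_inv M)"
proof -
  note M = mat_O_closeD(1)[OF F]
  note detM = det_nonzero_of_invertible[OF M inv]
  have ev: "\<forall>\<^sub>F b in at_top. F b \<in> carrier_mat k k \<and> det (F b) \<noteq> 0"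
    using mat_O_closeD(2)[OF F] tendsto_imp_eventually_ne[OF O_close_tendsto[OF O_close_det[OF F]] detM]
    by eventually_elim simp
  show "\<forall>\<^sub>F b in at_top. invertible_mat (F b)"
    using ev by eventually_elim (use mat_inv_adj_mat(1) in blast)
  have entry: "mat_inv A $$ (i,j) = inverse (det A) * ((- 1) ^ (j + i) * det (mat_delete A j i))"
    if "A \<in> carrier_mat k k" "det A \<noteq> 0" "i < k" "j < k" for A i j
    using that by (simp add: mat_inv_adj_mat(2)[of A k] adj_mat_def cofactor_def)
  show "mat_O_close k k (\<lambda>b. mat_inv (F b)) (mat_inv M)"
  proof (rule mat_O_closeI[where e = "\<lambda>i j b.
        inverse (det (F b)) * ((- 1) ^ (j + i) * det (mat_delete (F b) j i))"])
    show "mat_inv M \<in> carrier_mat k k" by (rule mat_inv(1)[OF M inv])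
    show "\<forall>\<^sub>F b in at_top. mat_inv (F b) \<in> carrier_mat k k"
      using ev by eventually_elim (use mat_inv(1) mat_inv_adj_mat(1) in blast)
    fix i j assume ij: "i < k" "j < k"
    show "\<forall>\<^sub>F b in at_top. mat_inv (F b) $$ (i,j)
        = inverse (det (F b)) * ((- 1) ^ (j + i) * det (mat_delete (F b) j i))"
      using ev by eventually_elim (use entry ij in blast)
    show "O_close (\<lambda>b. inverse (det (F b)) * ((- 1) ^ (j + i) * det (mat_delete (F b) j i)))
        (mat_inv M $$ (i,j))"
      unfolding entry[OF M detM ij]
      by (intro O_close_mult O_close_const O_close_inverse O_close_det[OF F] detM
          O_close_det[OF mat_O_close_mat_delete[OF F]] ij)
  qed
qed

lemma mat_O_close_schur_compl:
  assumes F: "mat_O_close n n F M" and C: "C \<subseteq> {..<n}" and D: "D \<subseteq> {..<n}"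
    and inv: "invertible_mat (submatrix M C C)"
  shows "mat_O_close (card D) (card D) (\<lambda>b. schur_compl (F b) C D) (schur_compl M C D)"
  unfolding schur_compl_def
  by (intro mat_O_close_diff mat_O_close_mult[where m = "card C"] mat_O_close_submatrix[OF F]
      mat_O_close_mat_inv(2)[OF _ inv] C D)

section \<open>The operator norm\<close>

text \<open>
  The crude upper bound by the sum of the moduli of the entries suffices because the dimension stays
  fixed while \<open>b\<close> grows.  The bound also makes the supremum in \<open>op_norm\<close> one of a bounded set, which the lower
  bound needs.
\<close>

lemma op_norm_bounds:
  assumes A: "A \<in> carrier_mat n m"
  shows "0 \<le> op_norm A" "op_norm A \<le> (\<Sum>i<n. \<Sum>j<m. cmod (A $$ (i,j)))"
proof -
  let ?B = "{v \<in> carrier_vec (dim_col A). vec_norm2 v \<le> 1}"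
  have zero: "0\<^sub>v m \<in> ?B" using A by (auto simp: vec_norm2_def L2_set_def)
  have bound: "vec_norm2 (A *\<^sub>v v) \<le> (\<Sum>i<n. \<Sum>j<m. cmod (A $$ (i,j)))" if "v \<in> ?B" for v
  proof -
    have v: "dim_vec v = m" "vec_norm2 v \<le> 1" using that A by auto
    have vj: "cmod (v $ j) \<le> 1" if "j < m" for j
      using member_le_L2_set[of "{..<m}" j "\<lambda>i. cmod (v $ i)"] that v by (simp add: vec_norm2_def)
    have "vec_norm2 (A *\<^sub>v v) \<le> (\<Sum>i<n. cmod ((A *\<^sub>v v) $ i))"
      unfolding vec_norm2_def using A by (auto intro: order_trans[OF L2_set_le_sum])
    also have "\<dots> \<le> (\<Sum>i<n. \<Sum>j<m. cmod (A $$ (i,j)))"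
    proof (rule sum_mono)
      fix i assume "i \<in> {..<n}"
      then have "(A *\<^sub>v v) $ i = (\<Sum>j<m. A $$ (i,j) * v $ j)"
        using A v by (auto simp: scalar_prod_def lessThan_atLeast0 intro!: sum.cong)
      also have "cmod \<dots> \<le> (\<Sum>j<m. cmod (A $$ (i,j) * v $ j))" by (rule norm_sum)
      also have "\<dots> \<le> (\<Sum>j<m. cmod (A $$ (i,j)))"
        by (rule sum_mono) (use vj in \<open>auto simp: norm_mult intro: mult_left_le\<close>)
      finally show "cmod ((A *\<^sub>v v) $ i) \<le> (\<Sum>j<m. cmod (A $$ (i,j)))" .
    qed
    finally show ?thesis .
  qed
  have bdd: "bdd_above ((\<lambda>v. vec_norm2 (A *\<^sub>v v)) ` ?B)" by (rule bdd_aboveI2[OF bound])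
  have "0 \<le> vec_norm2 (A *\<^sub>v 0\<^sub>v m)" by (simp add: vec_norm2_def L2_set_def sum_nonneg)
  also have "\<dots> \<le> op_norm A" unfolding op_norm_def by (rule cSUP_upper[OF zero bdd])
  finally show "0 \<le> op_norm A" .
  show "op_norm A \<le> (\<Sum>i<n. \<Sum>j<m. cmod (A $$ (i,j)))"
    unfolding op_norm_def by (rule cSUP_least) (use zero bound in auto)
qed

lemma op_norm_bigo:
  assumes F: "mat_O_close n m F M"
  shows "(\<lambda>b. op_norm (F b - M)) \<in> O[at_top](\<lambda>b. inverse b)"
proof -
  note M = mat_O_closeD(1)[OF F]
  have "(\<lambda>b. op_norm (F b - M)) \<in> O[at_top](\<lambda>b. \<Sum>i<n. \<Sum>j<m. cmod (F b $$ (i,j) - M $$ (i,j)))"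
  proof (rule landau_o.big_mono)
    show "\<forall>\<^sub>F b in at_top. norm (op_norm (F b - M))
        \<le> norm (\<Sum>i<n. \<Sum>j<m. cmod (F b $$ (i,j) - M $$ (i,j)))"
      using mat_O_closeD(2)[OF F]
    proof eventually_elim
      fix b assume Fb: "F b \<in> carrier_mat n m"
      have "F b - M \<in> carrier_mat n m" using Fb M by auto
      note bounds = op_norm_bounds[OF this]
      note bounds(2)
      also have "(\<Sum>i<n. \<Sum>j<m. cmod ((F b - M) $$ (i,j)))
          = (\<Sum>i<n. \<Sum>j<m. cmod (F b $$ (i,j) - M $$ (i,j)))"
        using Fb M by (auto intro!: sum.cong)
      finally show "norm (op_norm (F b - M)) \<le> norm (\<Sum>i<n. \<Sum>j<m. cmod (F b $$ (i,j) - M $$ (i,j)))"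
        using bounds(1) by simp
    qed
  qed
  also have "(\<lambda>b. \<Sum>i<n. \<Sum>j<m. cmod (F b $$ (i,j) - M $$ (i,j))) \<in> O[at_top](\<lambda>b. inverse b)"
  proof (intro big_sum_in_bigo)
    fix i j assume "i \<in> {..<n}" "j \<in> {..<m}"
    then have "(\<lambda>b. F b $$ (i,j) - M $$ (i,j)) \<in> O[at_top](\<lambda>b. inverse (complex_of_real b))"
      using mat_O_closeD(3)[OF F, of i j] by (simp add: O_close_def)
    then obtain c where "\<forall>\<^sub>F b in at_top. cmod (F b $$ (i,j) - M $$ (i,j)) \<le> c * cmod (inverse (complex_of_real b))"
      by (auto elim: landau_o.bigE)
    then show "(\<lambda>b. cmod (F b $$ (i,j) - M $$ (i,j))) \<in> O[at_top](\<lambda>b. inverse b)"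
      by (intro bigoI[where c = c]) (simp add: norm_inverse)
  qed
  finally show ?thesis .
qed

section \<open>Principal blocks of positive definite matrices\<close>

text \<open>
  A kernel vector of the block, extended by zero outside \<open>C\<close>, makes the quadratic form of \<open>K\<close> vanish:
  \<open>K w\<close> is zero on \<open>C\<close> and \<open>w\<close> is zero off \<open>C\<close>.
\<close>

lemma hermitian_pos_def_block_invertible:
  assumes K: "hermitian_pos_def n K" and C: "C \<subseteq> {..<n}"
  shows "invertible_mat (submatrix K C C)"
proof (rule ccontr)
  assume not_inv: "\<not> invertible_mat (submatrix K C C)"
  have Kc: "K \<in> carrier_mat n n" using K by (simp add: hermitian_pos_def_def)
  note KC = submatrix_carrier[OF Kc C C]
  have fin: "finite C" using C finite_subset by blast
  have "det (submatrix K C C) = 0" using not_inv mat_inv_adj_mat(1)[OF KC] by blast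
  then obtain v where v: "v \<in> carrier_vec (card C)" "v \<noteq> 0\<^sub>v (card C)"
    and Kv: "submatrix K C C *\<^sub>v v = 0\<^sub>v (card C)"
    using det_0_iff_vec_prod_zero[OF KC] by blast
  \<comment> \<open>\<open>card {a \<in> C. a < i}\<close> is the position of \<open>i\<close> in \<open>C\<close>, so \<open>w\<close> restricts to \<open>v\<close> on \<open>C\<close>.\<close>
  define w where "w = vec n (\<lambda>i. if i \<in> C then v $ card {a \<in> C. a < i} else 0)"
  have w: "w \<in> carrier_vec n" by (simp add: w_def)
  have w_pick: "w $ pick C k = v $ k" if "k < card C" for k
    using that pick_in_set_le[OF that] card_pick_le[OF that] C by (auto simp: w_def)
  have w_out: "w $ i = 0" if "i < n" "i \<notin> C" for i using that by (simp add: w_def)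
  obtain k where k: "k < card C" "v $ k \<noteq> 0" using v by (metis carrier_vecD eq_vecI index_zero_vec)
  have "w \<noteq> 0\<^sub>v n"
  proof
    assume "w = 0\<^sub>v n"
    then have "w $ pick C k = 0" using pick_in_set_le[OF k(1)] C by auto
    then show False using w_pick[OF k(1)] k(2) by simp
  qed
  then have pos: "Re ((K *\<^sub>v w) \<bullet>c w) > 0" using K w by (simp add: hermitian_pos_def_def)
  have Kw: "(K *\<^sub>v w) $ pick C i = 0" if i: "i < card C" for i
  proof -
    have pi: "pick C i < n" using pick_in_set_le[OF i] C by auto
    have "(K *\<^sub>v w) $ pick C i = (\<Sum>j<n. K $$ (pick C i, j) * w $ j)"
      using Kc w pi by (auto simp: scalar_prod_def lessThan_atLeast0 intro!: sum.cong)
    also have "\<dots> = (\<Sum>j\<in>C. K $$ (pick C i, j) * w $ j)"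
      by (rule sum.mono_neutral_right) (use C w_out in auto)
    also have "\<dots> = (\<Sum>l<card C. K $$ (pick C i, pick C l) * v $ l)"
      by (simp add: sum_pick[OF fin, symmetric] w_pick)
    also have "\<dots> = (submatrix K C C *\<^sub>v v) $ i"
      using KC v i by (auto simp: scalar_prod_def lessThan_atLeast0 submatrix_entry[OF Kc C C] intro!: sum.cong)
    finally show ?thesis using Kv i by simp
  qed
  have "(K *\<^sub>v w) \<bullet>c w = (\<Sum>i<n. (K *\<^sub>v w) $ i * cnj (w $ i))"
    using Kc w by (auto simp: scalar_prod_def lessThan_atLeast0 intro!: sum.cong)
  also have "\<dots> = (\<Sum>i\<in>C. (K *\<^sub>v w) $ i * cnj (w $ i))"
    by (rule sum.mono_neutral_right) (use C w_out in auto)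
  also have "\<dots> = (\<Sum>k<card C. (K *\<^sub>v w) $ pick C k * cnj (w $ pick C k))"
    by (rule sum_pick[OF fin, symmetric])
  also have "\<dots> = 0" using Kw by simp
  finally show False using pos by simp
qed

section \<open>Splitting off the divergent part\<close>

lemma O_close_inverse_scale:
  assumes "\<xi> \<noteq> 0"
  shows "O_close (\<lambda>b. inverse (\<i> * complex_of_real b * complex_of_real \<xi>)) 0"
proof -
  have "(\<lambda>b. inverse (\<i> * complex_of_real \<xi>) * inverse (complex_of_real b))
      \<in> O[at_top](\<lambda>b. inverse (complex_of_real b))"
    by simp
  then show ?thesis
    by (simp add: O_close_def inverse_mult_distrib mult.assoc mult.commute mult.left_commute)
qed

text \<open>
  With \<open>C\<close> listed first, \<open>row_op\<close> has the block rows \<open>[\<beta> I, 0]\<close> and \<open>[S\<^sub>D\<^sub>C, I]\<close>.  It carries everything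
  in \<open>S + \<beta> P\<close> that grows with \<open>\<beta>\<close>, and it has the shape to which \<open>schur_compl_congruence\<close> applies, with
  lower right block \<open>I\<close>.
\<close>

definition row_op :: "nat \<Rightarrow> nat set \<Rightarrow> complex mat \<Rightarrow> complex \<Rightarrow> complex mat" where
  "row_op n C S \<beta> = mat n n (\<lambda>(i,j).
     if i \<in> C then (if i = j then \<beta> else 0)
     else if j \<in> C then S $$ (i,j) else if i = j then 1 else 0)"

text \<open>
  In the same notation this is the block diagonal matrix with blocks \<open>I\<close> and \<open>S\<^sub>D\<^sub>D\<close>.
\<close>

definition reduced_limit :: "nat \<Rightarrow> nat set \<Rightarrow> complex mat \<Rightarrow> complex mat" where
  "reduced_limit n C S = mat n n (\<lambda>(i,j).
     if i \<in> C then (if i = j then 1 else 0) else if j \<in> C then 0 else S $$ (i,j))"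

text \<open>
  The \<open>C\<close> rows of \<open>S\<close> on top, and below them \<open>- S\<^sub>D\<^sub>C\<close> times these rows.
\<close>

definition reduced_corr :: "nat \<Rightarrow> nat set \<Rightarrow> complex mat \<Rightarrow> complex mat" where
  "reduced_corr n C S = mat n n (\<lambda>(i,j).
     if i \<in> C then S $$ (i,j) else - (\<Sum>k\<in>C. S $$ (i,k) * S $$ (k,j)))"

text \<open>
  The factor of \<open>S + \<beta> P\<close> that remains after \<open>row_op\<close> is split off; it converges as \<open>\<beta>\<close> grows.
\<close>

definition reduced :: "nat \<Rightarrow> nat set \<Rightarrow> complex mat \<Rightarrow> complex \<Rightarrow> complex mat" where
  "reduced n C S \<beta> = mat n n (\<lambda>(i,j).
     reduced_limit n C S $$ (i,j) + inverse \<beta> * reduced_corr n C S $$ (i,j))"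

lemma row_op_carrier: "row_op n C S \<beta> \<in> carrier_mat n n"
  by (simp add: row_op_def)

lemma reduced_carrier: "reduced n C S \<beta> \<in> carrier_mat n n"
  by (simp add: reduced_def)

lemma reduced_limit_carrier: "reduced_limit n C S \<in> carrier_mat n n"
  by (simp add: reduced_limit_def)

text \<open>
  On the \<open>C\<close> rows the factor \<open>\<beta>\<close> cancels the \<open>1/\<beta>\<close> in front of the correction.  On the \<open>D\<close> rows
  \<open>S\<^sub>D\<^sub>C\<close> times the \<open>C\<close> rows of \<open>reduced\<close> contributes the missing block \<open>S\<^sub>D\<^sub>C\<close>, and its
  \<open>1/\<beta>\<close> part cancels against the correction.
\<close>

lemma row_op_mult_reduced:
  assumes C: "C \<subseteq> {..<n}" and S: "S \<in> carrier_mat n n" and \<beta>: "\<beta> \<noteq> 0"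
  shows "row_op n C S \<beta> * reduced n C S \<beta> = S + \<beta> \<cdot>\<^sub>m mat_P n C"
proof (rule eq_matI)
  note c = row_op_carrier[of n C S \<beta>] reduced_carrier[of n C S \<beta>]
  have P: "mat_P n C \<in> carrier_mat n n" by (simp add: mat_P_def)
  show "dim_row (row_op n C S \<beta> * reduced n C S \<beta>) = dim_row (S + \<beta> \<cdot>\<^sub>m mat_P n C)"
    "dim_col (row_op n C S \<beta> * reduced n C S \<beta>) = dim_col (S + \<beta> \<cdot>\<^sub>m mat_P n C)"
    using c S P by auto
  have fin: "finite C" using C finite_subset by blast
  fix i j assume "i < dim_row (S + \<beta> \<cdot>\<^sub>m mat_P n C)" "j < dim_col (S + \<beta> \<cdot>\<^sub>m mat_P n C)"
  then have i: "i < n" and j: "j < n" using S P by auto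
  let ?R = "\<lambda>k. reduced n C S \<beta> $$ (k,j)"
  have RC: "?R k = (if k = j then 1 else 0) + inverse \<beta> * S $$ (k,j)" if "k \<in> C" for k
    using that C j by (auto simp: reduced_def reduced_limit_def reduced_corr_def)
  have rhs: "(S + \<beta> \<cdot>\<^sub>m mat_P n C) $$ (i,j) = S $$ (i,j) + (if i = j \<and> i \<in> C then \<beta> else 0)"
    using i j S by (auto simp: mat_P_def mat_diag_def)
  have "(row_op n C S \<beta> * reduced n C S \<beta>) $$ (i,j) = (\<Sum>k<n. row_op n C S \<beta> $$ (i,k) * ?R k)"
    by (rule mat_mult_entry[OF c i j])
  also have "\<dots> = (S + \<beta> \<cdot>\<^sub>m mat_P n C) $$ (i,j)"
  proof (cases "i \<in> C")
    case True
    have "(\<Sum>k<n. row_op n C S \<beta> $$ (i,k) * ?R k) = (\<Sum>k<n. if i = k then \<beta> * ?R k else 0)"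
      by (rule sum.cong) (use True i in \<open>auto simp: row_op_def\<close>)
    also have "\<dots> = \<beta> * ?R i" using i by simp
    finally show ?thesis unfolding rhs RC[OF True] using True \<beta> by (simp add: algebra_simps)
  next
    case False
    have "(\<Sum>k<n. row_op n C S \<beta> $$ (i,k) * ?R k)
        = (\<Sum>k<n. (if k \<in> C then S $$ (i,k) * ?R k else 0) + (if i = k then ?R k else 0))"
      by (rule sum.cong) (use False i in \<open>auto simp: row_op_def\<close>)
    also have "\<dots> = (\<Sum>k\<in>C. S $$ (i,k) * ?R k) + ?R i"
      using i C by (simp add: sum.distrib sum.inter_restrict[symmetric] Int_absorb1)
    also have "(\<Sum>k\<in>C. S $$ (i,k) * ?R k)
        = (\<Sum>k\<in>C. (if k = j then S $$ (i,k) else 0) + inverse \<beta> * (S $$ (i,k) * S $$ (k,j)))"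
      by (rule sum.cong) (auto simp: RC algebra_simps)
    also have "\<dots> = (if j \<in> C then S $$ (i,j) else 0) + inverse \<beta> * (\<Sum>k\<in>C. S $$ (i,k) * S $$ (k,j))"
      using fin by (simp add: sum.distrib sum_distrib_left)
    also have "?R i = (if j \<in> C then 0 else S $$ (i,j)) - inverse \<beta> * (\<Sum>k\<in>C. S $$ (i,k) * S $$ (k,j))"
      using False i j by (simp add: reduced_def reduced_limit_def reduced_corr_def)
    finally show ?thesis unfolding rhs using False by simp
  qed
  finally show "(row_op n C S \<beta> * reduced n C S \<beta>) $$ (i,j) = (S + \<beta> \<cdot>\<^sub>m mat_P n C) $$ (i,j)" .
qed

lemma
  assumes CD: "C \<union> D = {..<n}" "C \<inter> D = {}"
  shows row_op_CC: "submatrix (row_op n C S \<beta>) C C = \<beta> \<cdot>\<^sub>m 1\<^sub>m (card C)"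
    and row_op_CD: "submatrix (row_op n C S \<beta>) C D = 0\<^sub>m (card C) (card D)"
    and row_op_DD: "submatrix (row_op n C S \<beta>) D D = 1\<^sub>m (card D)"
    and reduced_limit_CC: "submatrix (reduced_limit n C S) C C = 1\<^sub>m (card C)"
    and reduced_limit_CD: "submatrix (reduced_limit n C S) C D = 0\<^sub>m (card C) (card D)"
    and reduced_limit_DD:
      "S \<in> carrier_mat n n \<Longrightarrow> submatrix (reduced_limit n C S) D D = submatrix S D D"
proof -
  have C: "C \<subseteq> {..<n}" and D: "D \<subseteq> {..<n}" using CD by auto
  have pC: "pick C i \<in> C" "pick C i < n" if "i < card C" for i
    using pick_in_set_le[OF that] C by auto
  have pD: "pick D i \<notin> C" "pick D i < n" if "i < card D" for i
    using pick_in_set_le[OF that] CD by auto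
  have pCD: "pick C i \<noteq> pick D j" if "i < card C" "j < card D" for i j
    using pC(1)[OF that(1)] pD(1)[OF that(2)] by metis
  note picks = pC pD pCD pick_eq_iff
  note b = row_op_carrier[of n C S \<beta>] and r = reduced_limit_carrier[of n C S]
  show "submatrix (row_op n C S \<beta>) C C = \<beta> \<cdot>\<^sub>m 1\<^sub>m (card C)"
    by (rule submatrix_eqI[OF b C C]) (auto simp: row_op_def picks)
  show "submatrix (row_op n C S \<beta>) C D = 0\<^sub>m (card C) (card D)"
    by (rule submatrix_eqI[OF b C D]) (auto simp: row_op_def picks)
  show "submatrix (row_op n C S \<beta>) D D = 1\<^sub>m (card D)"
    by (rule submatrix_eqI[OF b D D]) (auto simp: row_op_def picks)
  show "submatrix (reduced_limit n C S) C C = 1\<^sub>m (card C)"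
    by (rule submatrix_eqI[OF r C C]) (auto simp: reduced_limit_def picks)
  show "submatrix (reduced_limit n C S) C D = 0\<^sub>m (card C) (card D)"
    by (rule submatrix_eqI[OF r C D]) (auto simp: reduced_limit_def picks)
  show "submatrix (reduced_limit n C S) D D = submatrix S D D" if S: "S \<in> carrier_mat n n"
    by (rule submatrix_eqI[OF r D D submatrix_carrier[OF S D D]])
      (auto simp: reduced_limit_def picks submatrix_entry[OF S D D])
qed

lemma G_hat_factor:
  assumes C: "C \<subseteq> {..<n}" and S: "S \<in> carrier_mat n n" and K: "K \<in> carrier_mat n n"
    and \<beta>: "\<i> * complex_of_real b * complex_of_real \<xi> = \<beta>" "\<beta> \<noteq> 0"
  shows "G_hat n C S K \<xi> b = row_op n C S \<beta>
    * (reduced n C S \<beta> * K * mat_adjoint (reduced n C S \<beta>)) * mat_adjoint (row_op n C S \<beta>)"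
proof -
  define B R where "B = row_op n C S \<beta>" and "R = reduced n C S \<beta>"
  have B: "B \<in> carrier_mat n n" and R: "R \<in> carrier_mat n n"
    unfolding B_def R_def by (rule row_op_carrier reduced_carrier)+
  note adj = mat_adjoint_carrier[OF B] mat_adjoint_carrier[OF R]
  have "G_hat n C S K \<xi> b = (B * R) * K * mat_adjoint (B * R)"
    unfolding G_hat_def A_hat_def \<beta>(1) B_def R_def row_op_mult_reduced[OF C S \<beta>(2)] ..
  also have "\<dots> = B * (R * K * mat_adjoint R) * mat_adjoint B"
    unfolding mat_adjoint_mult[OF B R] using B R K adj by (simp add: mat_assoc_dim)
  finally show ?thesis unfolding B_def R_def .
qed

lemma mat_O_close_reduced:
  assumes "\<xi> \<noteq> 0"
  shows "mat_O_close n n (\<lambda>b. reduced n C S (\<i> * complex_of_real b * complex_of_real \<xi>)) (reduced_limit n C S)"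
proof (rule mat_O_closeI[where e = "\<lambda>i j b. reduced_limit n C S $$ (i,j)
      + inverse (\<i> * complex_of_real b * complex_of_real \<xi>) * reduced_corr n C S $$ (i,j)"])
  fix i j assume ij: "i < n" "j < n"
  show "O_close (\<lambda>b. reduced_limit n C S $$ (i,j)
      + inverse (\<i> * complex_of_real b * complex_of_real \<xi>) * reduced_corr n C S $$ (i,j))
      (reduced_limit n C S $$ (i,j))"
    using O_close_add[OF O_close_const O_close_mult[OF O_close_inverse_scale[OF assms] O_close_const]]
    by simp
qed (auto simp: reduced_def reduced_limit_carrier)

section \<open>The limit of the Schur complement\<close>

text \<open>
  For \<open>b > 0\<close> the Schur complement of \<open>G_hat\<close> equals that of \<open>M b\<close>, because \<open>row_op\<close> has lower right block \<open>I\<close>.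
  The matrices \<open>M b = R K R\<^sup>H\<close> converge to \<open>M\<^sub>0 = R\<^sub>0 K R\<^sub>0\<^sup>H\<close>, whose Schur complement exists and is again given by
  \<open>schur_compl_congruence\<close>, now with the block diagonal factor \<open>R\<^sub>0\<close>.  Invertibility of the \<open>C\<close> block
  travels the opposite way: from \<open>K\<close> to \<open>M\<^sub>0\<close>, by convergence to \<open>M b\<close>, and then to \<open>G_hat\<close>.
\<close>

lemma G_hat_schur_compl_limit:
  assumes CD: "C \<union> D = {..<n}" "C \<inter> D = {}" and S: "S \<in> carrier_mat n n"
    and \<xi>: "\<xi> \<noteq> 0" and Kpd: "hermitian_pos_def n K"
  shows "\<forall>\<^sub>F b in at_top. invertible_mat (submatrix (G_hat n C S K \<xi> b) C C)"
    and "mat_O_close (card D) (card D) (\<lambda>b. schur_compl (G_hat n C S K \<xi> b) C D)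
      (submatrix S D D * schur_compl K C D * mat_adjoint (submatrix S D D))"
proof -
  have C: "C \<subseteq> {..<n}" and D: "D \<subseteq> {..<n}" using CD by auto
  have K: "K \<in> carrier_mat n n" using Kpd by (simp add: hermitian_pos_def_def)
  define \<beta> where "\<beta> b = \<i> * complex_of_real b * complex_of_real \<xi>" for b
  define R where "R b = reduced n C S (\<beta> b)" for b
  define M where "M b = R b * K * mat_adjoint (R b)" for b
  define R\<^sub>0 where "R\<^sub>0 = reduced_limit n C S"
  define M\<^sub>0 where "M\<^sub>0 = R\<^sub>0 * K * mat_adjoint R\<^sub>0"
  have "mat_O_close n n R R\<^sub>0"
    unfolding R_def \<beta>_def R\<^sub>0_def by (rule mat_O_close_reduced[OF \<xi>])
  then have M: "mat_O_close n n M M\<^sub>0"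
    unfolding M_def M\<^sub>0_def
    by (intro mat_O_close_mult[where m = n] mat_O_close_const mat_O_close_adjoint K)
  have inv1: "invertible_mat (1\<^sub>m k :: complex mat)" for k
    by (rule invertible_mat_rightI[of _ k "1\<^sub>m k"]) auto
  have inv0: "invertible_mat (submatrix M\<^sub>0 C C)"
    and schur0: "schur_compl M\<^sub>0 C D
      = submatrix S D D * schur_compl K C D * mat_adjoint (submatrix S D D)"
    using schur_compl_congruence[OF K reduced_limit_carrier CD reduced_limit_CD[OF CD] _
        hermitian_pos_def_block_invertible[OF Kpd C], folded R\<^sub>0_def]
    by (simp_all add: R\<^sub>0_def M\<^sub>0_def reduced_limit_CC[OF CD] reduced_limit_DD[OF CD S] inv1)
  have ev: "\<forall>\<^sub>F b in at_top. invertible_mat (submatrix (G_hat n C S K \<xi> b) C C)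
      \<and> schur_compl (G_hat n C S K \<xi> b) C D = schur_compl (M b) C D"
    using mat_O_close_mat_inv(1)[OF mat_O_close_submatrix[OF M C C] inv0] eventually_gt_at_top[of 0]
  proof eventually_elim
    fix b :: real
    assume invM: "invertible_mat (submatrix (M b) C C)" and b: "0 < b"
    have \<beta>0: "\<beta> b \<noteq> 0" using b \<xi> by (simp add: \<beta>_def)
    have Mb: "M b \<in> carrier_mat n n"
      unfolding M_def R_def
      by (intro mult_carrier_mat[of _ n n] mat_adjoint_carrier reduced_carrier K)
    have G: "G_hat n C S K \<xi> b = row_op n C S (\<beta> b) * M b * mat_adjoint (row_op n C S (\<beta> b))"
      unfolding M_def R_def by (rule G_hat_factor[OF C S K _ \<beta>0]) (simp add: \<beta>_def)
    have "invertible_mat (submatrix (row_op n C S (\<beta> b)) C C)"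
      unfolding row_op_CC[OF CD]
      by (rule mat_inv_adj_mat(1)[of _ "card C"]) (use \<beta>0 in auto)
    note congr = schur_compl_congruence[OF Mb row_op_carrier CD row_op_CD[OF CD] this invM, folded G]
    have "schur_compl (G_hat n C S K \<xi> b) C D = schur_compl (M b) C D"
      using congr(2) schur_compl_carrier[OF Mb D, of C]
      by (simp add: row_op_DD[OF CD] mat_adjoint_one)
    with congr(1) show "invertible_mat (submatrix (G_hat n C S K \<xi> b) C C)
      \<and> schur_compl (G_hat n C S K \<xi> b) C D = schur_compl (M b) C D" ..
  qed
  from ev show "\<forall>\<^sub>F b in at_top. invertible_mat (submatrix (G_hat n C S K \<xi> b) C C)"
    by eventually_elim simp
  from ev have "\<forall>\<^sub>F b in at_top. schur_compl (G_hat n C S K \<xi> b) C D = schur_compl (M b) C D"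
    by eventually_elim simp
  from mat_O_close_cong[OF this] mat_O_close_schur_compl[OF M C D inv0]
  show "mat_O_close (card D) (card D) (\<lambda>b. schur_compl (G_hat n C S K \<xi> b) C D)
      (submatrix S D D * schur_compl K C D * mat_adjoint (submatrix S D D))"
    unfolding schur0 by simp
qed

theorem theorem4p1:
  fixes n m :: nat and C D :: "nat set" and S K :: "complex mat" and \<xi> :: real
  assumes "n \<ge> 2"
    and "C \<union> D = {..<n}" and "C \<inter> D = {}"
    and "card C = m" and "m \<ge> 1"
    and "card D = n - m" and "n - m \<ge> 1"
    and "S \<in> carrier_mat n n"
    and "\<xi> \<noteq> 0"
    and "hermitian_pos_def n K"
  shows "(\<forall>\<^sub>F b in at_top. invertible_mat (submatrix (G_hat n C S K \<xi> b) C C))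
    \<and> (\<lambda>b. op_norm (schur_compl (G_hat n C S K \<xi> b) C D
              - submatrix S D D * schur_compl K C D * mat_adjoint (submatrix S D D)))
        \<in> O[at_top](\<lambda>b. inverse b)
    \<and> (\<exists>L \<in> carrier_mat (n - m) (n - m).
          \<forall>S' K'. S' \<in> carrier_mat n n \<and> hermitian_pos_def n K'
              \<and> submatrix S' D D = submatrix S D D
              \<and> schur_compl K' C D = schur_compl K C D \<longrightarrow>
            ((\<lambda>b. op_norm (schur_compl (G_hat n C S' K' \<xi> b) C D - L)) \<longlongrightarrow> 0) at_top)"
proof (intro conjI)
  note CD = assms(2,3)
  note limit = G_hat_schur_compl_limit[OF CD _ assms(9)]
  let ?L = "submatrix S D D * schur_compl K C D * mat_adjoint (submatrix S D D)"
  show "\<forall>\<^sub>F b in at_top. invertible_mat (submatrix (G_hat n C S K \<xi> b) C C)"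
    by (rule limit(1)[OF assms(8,10)])
  show "(\<lambda>b. op_norm (schur_compl (G_hat n C S K \<xi> b) C D - ?L)) \<in> O[at_top](\<lambda>b. inverse b)"
    by (rule op_norm_bigo[OF limit(2)[OF assms(8,10)]])
  show "\<exists>L \<in> carrier_mat (n - m) (n - m).
      \<forall>S' K'. S' \<in> carrier_mat n n \<and> hermitian_pos_def n K'
        \<and> submatrix S' D D = submatrix S D D \<and> schur_compl K' C D = schur_compl K C D \<longrightarrow>
        ((\<lambda>b. op_norm (schur_compl (G_hat n C S' K' \<xi> b) C D - L)) \<longlongrightarrow> 0) at_top"
  proof (intro bexI[of _ ?L] allI impI)
    show "?L \<in> carrier_mat (n - m) (n - m)"
      using mat_O_closeD(1)[OF limit(2)[OF assms(8,10)]] unfolding assms(6) .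
    fix S' K'
    assume *: "S' \<in> carrier_mat n n \<and> hermitian_pos_def n K'
      \<and> submatrix S' D D = submatrix S D D \<and> schur_compl K' C D = schur_compl K C D"
    then have "(\<lambda>b. op_norm (schur_compl (G_hat n C S' K' \<xi> b) C D - ?L)) \<in> O[at_top](\<lambda>b. inverse b)"
      using op_norm_bigo[OF limit(2), of S' K'] by simp
    moreover have "(\<lambda>b::real. inverse b) \<in> o[at_top](\<lambda>_. 1)"
      by (rule smalloI_tendsto) (use tendsto_inverse_0_at_top[OF filterlim_ident] in simp_all)
    ultimately have "(\<lambda>b. op_norm (schur_compl (G_hat n C S' K' \<xi> b) C D - ?L)) \<in> o[at_top](\<lambda>_. 1)"
      by (rule landau_o.big_small_trans)
    from smalloD_tendsto[OF this]
    show "((\<lambda>b. op_norm (schur_compl (G_hat n C S' K' \<xi> b) C D - ?L)) \<longlongrightarrow> 0) at_top" by simp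
  qed
qed

end
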